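(* Let $m,n\in\mathbb{N}=\{1,2,\dotsc\}$, let $x>0$, and let $\mu_{ij}>0$ for $1\le i\le m$ and $1\le j\le n$. Put $\nu_i=\sum_{j=1}^{n}\mu_{ij}$ for $1\le i\le m$ and $\tau_j=\sum_{i=1}^{m}\mu_{ij}$ for $1\le j\le n$. Then $$ \sum_{i=1}^{m}\frac1{e^{x/\nu_i}-1}+\sum_{j=1}^{n}\frac1{e^{x/\tau_j}-1} \ge2\sum_{i=1}^{m}\sum_{j=1}^{n}\frac1{e^{x/\mu_{ij}}-1}. $$ *)

theory Defs
  imports Complex_Main
begin

end

theory Submission
  imports Defs
begin

text \<open>
  For fixed \<open>x > 0\<close>, the function \<open>f(a) = 1 / (exp (x / a) - 1)\<close> is superadditive on the
  positive reals, because \<open>f(a) / a\<close> is increasing: with \<open>t = x / a\<close> this is the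
  statement that the chord slope \<open>(exp t - 1) / t\<close> of the convex function \<open>exp\<close> increases with \<open>t\<close>.
  Superadditivity along every row bounds the double sum by the sum of \<open>f\<close> over the row sums,
  superadditivity along every column bounds it by the sum of \<open>f\<close> over the column sums, and the
  claim is the sum of these two bounds.
\<close>

text \<open>
  Convexity of \<open>exp\<close> on the segment from \<open>0\<close> to \<open>t\<close>: the chord lies above the tangent at \<open>r * t\<close>,
  so it suffices to average the tangent-line bounds at the two ends with weights \<open>1 - r\<close> and \<open>r\<close>;
  the first-order terms cancel.
\<close>

lemma exp_mult_le_chord:
  fixes r t :: real
  assumes "0 \<le> r" "r \<le> 1"
  shows "exp (r * t) - 1 \<le> r * (exp t - 1)"
proof -
  have tangent: "exp (r * t) * (1 + (u - r * t)) \<le> exp u" for u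
  proof -
    have "exp (r * t) * (1 + (u - r * t)) \<le> exp (r * t) * exp (u - r * t)"
      using exp_ge_add_one_self[of "u - r * t"] by (intro mult_left_mono) auto
    then show ?thesis by (simp add: exp_add[symmetric])
  qed
  have "(1 - r) * (exp (r * t) * (1 + (0 - r * t))) + r * (exp (r * t) * (1 + (t - r * t)))
      \<le> (1 - r) * exp 0 + r * exp t"
    using assms by (intro add_mono mult_left_mono tangent) auto
  then show ?thesis by (simp add: algebra_simps)
qed

text \<open>
  The monotonicity of \<open>f(a) / a\<close>, cleared of the denominator \<open>a\<close>: the exponents satisfy
  \<open>x / b = (a / b) * (x / a)\<close>, so the chord inequality applies with ratio \<open>a / b\<close>.
\<close>

lemma inverse_exp_div_minus_one_le_scaled:
  fixes a b x :: real
  assumes "0 < x" "0 < a" "a \<le> b"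
  shows "1 / (exp (x / a) - 1) \<le> a / b * (1 / (exp (x / b) - 1))"
proof -
  have "exp (a / b * (x / a)) - 1 \<le> a / b * (exp (x / a) - 1)"
    using assms by (intro exp_mult_le_chord) auto
  then have chord: "exp (x / b) - 1 \<le> a / b * (exp (x / a) - 1)"
    using assms by simp
  have "0 < exp (x / a) - 1" "0 < exp (x / b) - 1"
    using assms by auto
  then show ?thesis
    using chord assms by (simp add: divide_simps mult.commute)
qed

text \<open>
  Superadditivity: each entry \<open>a j\<close> contributes at most its share \<open>a j / sum a A\<close> of the
  right-hand side, and the shares add up to one.
\<close>

lemma sum_inverse_exp_div_minus_one_le:
  fixes a :: "'a \<Rightarrow> real" and x :: real
  assumes "finite A" "A \<noteq> {}" "0 < x" and pos: "\<And>j. j \<in> A \<Longrightarrow> 0 < a j"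
  shows "(\<Sum>j\<in>A. 1 / (exp (x / a j) - 1)) \<le> 1 / (exp (x / sum a A) - 1)"
proof -
  have "0 < sum a A"
    using assms by (intro sum_pos) auto
  have "(\<Sum>j\<in>A. 1 / (exp (x / a j) - 1))
      \<le> (\<Sum>j\<in>A. a j / sum a A * (1 / (exp (x / sum a A) - 1)))"
  proof (rule sum_mono)
    fix j assume "j \<in> A"
    then have "a j \<le> sum a A"
      using assms by (intro member_le_sum) (auto intro: less_imp_le)
    then show "1 / (exp (x / a j) - 1) \<le> a j / sum a A * (1 / (exp (x / sum a A) - 1))"
      using \<open>j \<in> A\<close> assms by (intro inverse_exp_div_minus_one_le_scaled) auto
  qed
  also have "\<dots> = sum a A / sum a A * (1 / (exp (x / sum a A) - 1))"
    by (simp only: sum_distrib_right sum_divide_distrib)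
  also have "\<dots> = 1 / (exp (x / sum a A) - 1)"
    using \<open>0 < sum a A\<close> by simp
  finally show ?thesis .
qed

theorem theorem3p1:
  fixes m n :: nat and x :: real
    and \<mu> :: "nat \<Rightarrow> nat \<Rightarrow> real" and \<nu> \<tau> :: "nat \<Rightarrow> real"
  assumes "m \<ge> 1" and "n \<ge> 1" and "x > 0"
    and "\<And>i j. i \<in> {1..m} \<Longrightarrow> j \<in> {1..n} \<Longrightarrow> \<mu> i j > 0"
    and "\<And>i. i \<in> {1..m} \<Longrightarrow> \<nu> i = (\<Sum>j=1..n. \<mu> i j)"
    and "\<And>j. j \<in> {1..n} \<Longrightarrow> \<tau> j = (\<Sum>i=1..m. \<mu> i j)"
  shows "(\<Sum>i=1..m. 1 / (exp (x / \<nu> i) - 1)) + (\<Sum>j=1..n. 1 / (exp (x / \<tau> j) - 1))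
    \<ge> 2 * (\<Sum>i=1..m. \<Sum>j=1..n. 1 / (exp (x / \<mu> i j) - 1))"
proof -
  let ?S = "\<Sum>i=1..m. \<Sum>j=1..n. 1 / (exp (x / \<mu> i j) - 1)"
  have rows: "?S \<le> (\<Sum>i=1..m. 1 / (exp (x / \<nu> i) - 1))"
  proof (rule sum_mono)
    fix i assume i: "i \<in> {1..m}"
    show "(\<Sum>j=1..n. 1 / (exp (x / \<mu> i j) - 1)) \<le> 1 / (exp (x / \<nu> i) - 1)"
      unfolding assms(5)[OF i]
      using assms(2,3) assms(4)[OF i] by (intro sum_inverse_exp_div_minus_one_le) auto
  qed
  have "?S = (\<Sum>j=1..n. \<Sum>i=1..m. 1 / (exp (x / \<mu> i j) - 1))"
    by (rule sum.swap)
  also have "\<dots> \<le> (\<Sum>j=1..n. 1 / (exp (x / \<tau> j) - 1))"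
  proof (rule sum_mono)
    fix j assume j: "j \<in> {1..n}"
    show "(\<Sum>i=1..m. 1 / (exp (x / \<mu> i j) - 1)) \<le> 1 / (exp (x / \<tau> j) - 1)"
      unfolding assms(6)[OF j]
      using assms(1,3) assms(4)[OF _ j] by (intro sum_inverse_exp_div_minus_one_le) auto
  qed
  finally show ?thesis using rows by simp
qed

end
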